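(* Let $\tau\in(0,1]$. No deterministic algorithm for MinSet under stochastic explorable uncertainty (with distributions unknown to the algorithm) has a competitive ratio better than $2/\tau$ on the class of instances with balancing parameter $\tau$, even if all sets in $\mathcal{S}$ are pairwise disjoint. That is, for every deterministic algorithm $\mathrm{ALG}$, $\sup_J \mathbb{E}[\mathrm{ALG}(J)]/\mathbb{E}[\mathrm{OPT}(J)]\ge 2/\tau$, the supremum ranging over such instances $J$.
   Context: An instance of MinSet under stochastic explorable uncertainty consists of a finite set of uncertainty intervals $\mathcal{I}=\{I_1,\dots,I_n\}$ and a family $\mathcal{S}=\{S_1,\dots,S_m\}$ of subsets of $\mathcal{I}$. Each interval is either open, $I_i=(L_i,U_i)$ with $L_i<U_i$, or trivial, $I_i=\{w_i\}$ with $L_i=U_i=w_i$. Each $I_i$ has a value $w_i\in I_i$, drawn independently according to a distribution $d_i$ on $I_i$ which is unknown to the algorithm (the algorithm only sees the intervals and sets); querying $I_i$ reveals $w_i$. For $S\in\mathcal{S}$ let $w(S)=\sum_{I_i\in S}w_i$, and for a set $Q\subseteq\mathcal{I}$ of queried intervals let $L_S(Q)=\sum_{I_i\in S\setminus Q}L_i+\sum_{I_i\in S\cap Q}w_i$ and $U_S(Q)=\sum_{I_i\in S\setminus Q}U_i+\sum_{I_i\in S\cap Q}w_i$. Let $w^*=\min_{S\in\mathcal{S}}w(S)$. A set $Q\subseteq\mathcal{I}$ is feasible if there is $S^*\in\mathcal{S}$ with $L_{S^*}(Q)=U_{S^*}(Q)=w^*$ and $L_S(Q)\ge w^*$ for all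 $S\in\mathcal{S}$. An algorithm adaptively queries intervals (each choice may depend on earlier query results) until its set of queried intervals is feasible; $\mathrm{ALG}(J)$ is its number of queries on instance $J$, and $\mathrm{OPT}(J)$ is the minimum cardinality of a feasible set for the realized values. The competitive ratio of an algorithm on a class of instances is $\sup_J \mathbb{E}[\mathrm{ALG}(J)]/\mathbb{E}[\mathrm{OPT}(J)]$. For each $I_i$ let $\tau_i=\Pr[w_i\ge (U_i+L_i)/2]$; the balancing parameter is $\tau=\min_{I_i\in\mathcal{I}}\tau_i$. *)

theory Defs
  imports "HOL-Probability.Probability" "HOL-Library.Disjoint_Sets"
begin

text \<open>The part of an instance that the algorithm sees. Interval \<open>i\<close> is represented by the
  pair \<open>(L\<^sub>i, U\<^sub>i)\<close> at position \<open>i\<close> of the list, so distinct intervals may have the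
  same endpoints; sets of intervals are sets of positions.\<close>

record minset_input =
  intervals :: "(real \<times> real) list"
  family :: "nat set set"

definition items :: "minset_input \<Rightarrow> nat set" where
  "items P = {..<length (intervals P)}"

definition lower :: "minset_input \<Rightarrow> nat \<Rightarrow> real" where
  "lower P i = fst (intervals P ! i)"

definition upper :: "minset_input \<Rightarrow> nat \<Rightarrow> real" where
  "upper P i = snd (intervals P ! i)"

definition interval :: "minset_input \<Rightarrow> nat \<Rightarrow> real set" where
  "interval P i = (if lower P i = upper P i then {lower P i} else {lower P i<..<upper P i})"

definition valid_input :: "minset_input \<Rightarrow> bool" where
  "valid_input P \<longleftrightarrow>
     items P \<noteq> {} \<and> (\<forall>i\<in>items P. lower P i \<le> upper P i) \<and>
     family P \<noteq> {} \<and> (\<forall>S\<in>family P. S \<subseteq> items P)"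

definition set_value :: "(nat \<Rightarrow> real) \<Rightarrow> nat set \<Rightarrow> real" where
  "set_value w S = (\<Sum>i\<in>S. w i)"

definition lower_limit :: "minset_input \<Rightarrow> (nat \<Rightarrow> real) \<Rightarrow> nat set \<Rightarrow> nat set \<Rightarrow> real" where
  "lower_limit P w Q S = (\<Sum>i\<in>S - Q. lower P i) + (\<Sum>i\<in>S \<inter> Q. w i)"

definition upper_limit :: "minset_input \<Rightarrow> (nat \<Rightarrow> real) \<Rightarrow> nat set \<Rightarrow> nat set \<Rightarrow> real" where
  "upper_limit P w Q S = (\<Sum>i\<in>S - Q. upper P i) + (\<Sum>i\<in>S \<inter> Q. w i)"

definition min_value :: "minset_input \<Rightarrow> (nat \<Rightarrow> real) \<Rightarrow> real" where
  "min_value P w = Min (set_value w ` family P)"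

definition feasible :: "minset_input \<Rightarrow> (nat \<Rightarrow> real) \<Rightarrow> nat set \<Rightarrow> bool" where
  "feasible P w Q \<longleftrightarrow>
     Q \<subseteq> items P \<and>
     (\<exists>S\<in>family P. lower_limit P w Q S = min_value P w \<and> upper_limit P w Q S = min_value P w) \<and>
     (\<forall>S\<in>family P. lower_limit P w Q S \<ge> min_value P w)"

definition opt :: "minset_input \<Rightarrow> (nat \<Rightarrow> real) \<Rightarrow> nat" where
  "opt P w = Min (card ` {Q. feasible P w Q})"

text \<open>A deterministic algorithm maps the visible input and the list of earlier queries with their
  results to the next interval to query.\<close>

type_synonym strategy = "minset_input \<Rightarrow> (nat \<times> real) list \<Rightarrow> nat"

definition deterministic_algorithm :: "strategy \<Rightarrow> bool" where
  "deterministic_algorithm A \<longleftrightarrow> (\<forall>P h. valid_input P \<longrightarrow> A P h \<in> items P)"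

primrec history :: "strategy \<Rightarrow> minset_input \<Rightarrow> (nat \<Rightarrow> real) \<Rightarrow> nat \<Rightarrow> (nat \<times> real) list" where
  "history A P w 0 = []"
| "history A P w (Suc k) =
     (let h = history A P w k; i = A P h in h @ [(i, w i)])"

definition queried :: "strategy \<Rightarrow> minset_input \<Rightarrow> (nat \<Rightarrow> real) \<Rightarrow> nat \<Rightarrow> nat set" where
  "queried A P w k = fst ` set (history A P w k)"

text \<open>The algorithm stops as soon as the queried set is feasible. Repeating a query is possible but
  counts again, and the cost is \<open>\<infinity>\<close> if the queried set never becomes feasible.\<close>

definition alg :: "strategy \<Rightarrow> minset_input \<Rightarrow> (nat \<Rightarrow> real) \<Rightarrow> enat" where
  "alg A P w = (INF k\<in>{k. feasible P w (queried A P w k)}. enat k)"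

type_synonym minset_instance = "minset_input \<times> (nat \<Rightarrow> real measure)"

definition valid_instance :: "minset_instance \<Rightarrow> bool" where
  "valid_instance J \<longleftrightarrow> (case J of (P, d) \<Rightarrow>
     valid_input P \<and>
     (\<forall>i\<in>items P. prob_space (d i) \<and> sets (d i) = sets borel \<and>
        (AE x in d i. x \<in> interval P i)))"

text \<open>Independence of the values is expressed by the product measure.\<close>

definition value_space :: "minset_instance \<Rightarrow> (nat \<Rightarrow> real) measure" where
  "value_space J = (case J of (P, d) \<Rightarrow> PiM (items P) d)"

definition expected_alg :: "strategy \<Rightarrow> minset_instance \<Rightarrow> ennreal" where
  "expected_alg A J = (\<integral>\<^sup>+ w. ennreal_of_enat (alg A (fst J) w) \<partial>value_space J)"

definition expected_opt :: "minset_instance \<Rightarrow> ennreal" where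
  "expected_opt J = (\<integral>\<^sup>+ w. of_nat (opt (fst J) w) \<partial>value_space J)"

definition balancing :: "minset_instance \<Rightarrow> real" where
  "balancing J = (case J of (P, d) \<Rightarrow>
     Min ((\<lambda>i. measure (d i) {x. x \<ge> (upper P i + lower P i) / 2}) ` items P))"

text \<open>If the expected optimum is \<open>0\<close>, then almost surely the empty set is feasible and the algorithm
  makes no query; such instances contribute \<open>0 / 0 = 0\<close> and do not affect the supremum.
  For a strategy whose cost is not measurable the expectation is the lower integral.\<close>

definition competitive_ratio :: "strategy \<Rightarrow> minset_instance set \<Rightarrow> ennreal" where
  "competitive_ratio A C = (SUP J\<in>C. expected_alg A J / expected_opt J)"

end

theory Submission
  imports Defs "HOL-Real_Asymp.Real_Asymp"
begin

text \<open>One set consists of \<open>n\<close> intervals \<open>(0, 1)\<close> and competes with a trivial set of value \<open>3/4\<close>.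
  A special item \<open>j\<close> has value at least \<open>7/8\<close>, so querying it alone is optimal. Every other item
  has value \<open>1/2\<close> with probability \<open>\<tau>\<close> and is negligible otherwise, so an algorithm that misses
  \<open>j\<close> needs two items of value \<open>1/2\<close>. Let \<open>X\<close> be the expected time, truncated at \<open>K\<close>, to find two
  such items, and \<open>p\<close> the probability that \<open>K\<close> queries do not suffice. Wald's identity gives
  \<open>2 (1 - p) \<le> \<tau> X\<close>, and \<open>K p \<le> X\<close>, whence \<open>X \<ge> 2 K / (\<tau> K + 2)\<close>. The first \<open>K\<close> queries
  see at most \<open>K\<close> of the \<open>n\<close> possible positions of \<open>j\<close>, so for some \<open>j\<close> the expected cost is at
  least \<open>(1 - K/n) X\<close>. With \<open>n = K\<^sup>2\<close> this tends to \<open>2/\<tau>\<close>.\<close>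

subsection \<open>Independent coins\<close>

text \<open>The probability that exactly the coins in \<open>B\<close> succeed, for \<open>B\<close>
  a subset of \<open>I\<close>. Expectations become finite sums over subsets, so functions of a
  strategy's run raise no measurability question.\<close>

definition coin_weight :: "real \<Rightarrow> 'a set \<Rightarrow> 'a set \<Rightarrow> real" where
  "coin_weight \<tau> I B = (\<Prod>i\<in>I. if i \<in> B then \<tau> else 1 - \<tau>)"

definition coin_mean :: "real \<Rightarrow> 'a set \<Rightarrow> ('a set \<Rightarrow> real) \<Rightarrow> real" where
  "coin_mean \<tau> I f = (\<Sum>B\<in>Pow I. coin_weight \<tau> I B * f B)"

lemma coin_weight_nonneg:
  assumes "0 \<le> \<tau>" "\<tau> \<le> 1"
  shows "0 \<le> coin_weight \<tau> I B"
  unfolding coin_weight_def using assms by (intro prod_nonneg) auto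

lemma coin_weight_insert:
  assumes "finite I" "i \<notin> I"
  shows "coin_weight \<tau> (insert i I) B = (if i \<in> B then \<tau> else 1 - \<tau>) * coin_weight \<tau> I B"
  using assms by (simp add: coin_weight_def)

lemma coin_weight_insert_outcome:
  assumes "i \<notin> I"
  shows "coin_weight \<tau> I (insert i B) = coin_weight \<tau> I B"
  unfolding coin_weight_def using assms by (intro prod.cong) auto

text \<open>Conditioning on coin \<open>i\<close>.\<close>

lemma coin_mean_insert:
  assumes "finite I" "i \<notin> I"
  shows "coin_mean \<tau> (insert i I) f =
    \<tau> * coin_mean \<tau> I (\<lambda>B. f (insert i B)) + (1 - \<tau>) * coin_mean \<tau> I f"
proof -
  have inj: "inj_on (insert i) (Pow I)"
    using assms by (auto simp: inj_on_def)
  have "coin_mean \<tau> (insert i I) f =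
      (\<Sum>B\<in>Pow I. coin_weight \<tau> (insert i I) B * f B) +
      (\<Sum>B\<in>insert i ` Pow I. coin_weight \<tau> (insert i I) B * f B)"
    unfolding coin_mean_def Pow_insert using assms by (intro sum.union_disjoint) auto
  also have "(\<Sum>B\<in>Pow I. coin_weight \<tau> (insert i I) B * f B) = (1 - \<tau>) * coin_mean \<tau> I f"
    unfolding coin_mean_def sum_distrib_left using assms
    by (intro sum.cong) (auto simp: coin_weight_insert)
  also have "(\<Sum>B\<in>insert i ` Pow I. coin_weight \<tau> (insert i I) B * f B) =
      \<tau> * coin_mean \<tau> I (\<lambda>B. f (insert i B))"
    unfolding coin_mean_def sum_distrib_left using assms
    by (subst sum.reindex[OF inj])
      (auto intro!: sum.cong simp: coin_weight_insert coin_weight_insert_outcome)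
  finally show ?thesis by simp
qed

lemma coin_mean_const:
  assumes "finite I"
  shows "coin_mean \<tau> I (\<lambda>_. c) = c"
  using assms
proof induction
  case empty
  show ?case by (simp add: coin_mean_def coin_weight_def)
next
  case (insert i I)
  then show ?case by (simp add: coin_mean_insert algebra_simps)
qed

lemma coin_mean_mono:
  assumes "0 \<le> \<tau>" "\<tau> \<le> 1" "\<And>B. B \<subseteq> I \<Longrightarrow> f B \<le> g B"
  shows "coin_mean \<tau> I f \<le> coin_mean \<tau> I g"
  unfolding coin_mean_def using assms
  by (intro sum_mono mult_left_mono coin_weight_nonneg) auto

lemma coin_mean_sum: "coin_mean \<tau> I (\<lambda>B. \<Sum>x\<in>X. f x B) = (\<Sum>x\<in>X. coin_mean \<tau> I (f x))"
  unfolding coin_mean_def sum_distrib_left by (rule sum.swap)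

lemma coin_mean_cmult: "coin_mean \<tau> I (\<lambda>B. c * f B) = c * coin_mean \<tau> I f"
  unfolding coin_mean_def sum_distrib_left by (intro sum.cong) auto

lemma coin_mean_diff: "coin_mean \<tau> I (\<lambda>B. f B - g B) = coin_mean \<tau> I f - coin_mean \<tau> I g"
  unfolding coin_mean_def by (simp add: algebra_simps sum_subtractf)

text \<open>The last hypothesis says that \<open>f\<close> ignores coin \<open>i\<close>. After
  conditioning on that coin, only the branch of weight \<tau> survives, and there \<open>f\<close>
  has its usual mean.\<close>

lemma coin_mean_independent:
  assumes "finite I" "i \<in> I" "\<And>B. f (insert i B) = f (B - {i})"
  shows "coin_mean \<tau> I (\<lambda>B. f B * of_bool (i \<in> B)) = \<tau> * coin_mean \<tau> I f"
proof -
  define I' where "I' = I - {i}"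
  have I: "I = insert i I'" "finite I'" "i \<notin> I'"
    using assms by (auto simp: I'_def)
  have "coin_mean \<tau> I' (\<lambda>B. f (insert i B)) = coin_mean \<tau> I' f"
    unfolding coin_mean_def
  proof (intro sum.cong refl)
    fix B assume "B \<in> Pow I'"
    then have "B - {i} = B" using I(3) by auto
    then show "coin_weight \<tau> I' B * f (insert i B) = coin_weight \<tau> I' B * f B"
      by (simp add: assms(3))
  qed
  moreover have "coin_mean \<tau> I' (\<lambda>B. f B * of_bool (i \<in> B)) = 0"
    unfolding coin_mean_def using I(3) by (intro sum.neutral) auto
  ultimately show ?thesis
    unfolding I(1) by (simp add: coin_mean_insert I(2,3) algebra_simps)
qed

subsection \<open>Runs of a strategy\<close>

lemma queried_0 [simp]: "queried A P w 0 = {}"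
  by (simp add: queried_def)

lemma queried_Suc [simp]:
  "queried A P w (Suc k) = insert (A P (history A P w k)) (queried A P w k)"
  by (simp add: queried_def Let_def)

lemma finite_queried [simp]: "finite (queried A P w k)"
  by (simp add: queried_def)

lemma card_queried_le: "card (queried A P w k) \<le> k"
  by (induction k) (simp_all add: card_insert_if)

lemma queried_mono: "k \<le> l \<Longrightarrow> queried A P w k \<subseteq> queried A P w l"
  by (induction l) (auto simp: le_Suc_eq)

text \<open>The next query depends only on the history, so agreement on the items queried in one run
  suffices. This serves both for hiding an uninspected coin and for changing the special
  item.\<close>

lemma history_cong:
  assumes "\<And>i. i \<in> queried A P w k \<Longrightarrow> w' i = w i"
  shows "history A P w' k = history A P w k"
  using assms by (induction k) (auto simp: Let_def)

lemma queried_cong: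
  assumes "\<And>i. i \<in> queried A P w k \<Longrightarrow> w' i = w i"
  shows "queried A P w' k = queried A P w k"
  unfolding queried_def using history_cong[OF assms] by simp

subsection \<open>The time needed to find two successful coins\<close>

text \<open>A strategy looks at coins through values \<open>w B i\<close> that reveal at most whether \<open>i \<in> B\<close>.\<close>

locale coin_search =
  fixes A :: strategy and P :: minset_input and w :: "nat set \<Rightarrow> nat \<Rightarrow> real"
    and I :: "nat set" and \<tau> :: real
  assumes local_values: "(i \<in> B \<longleftrightarrow> i \<in> B') \<Longrightarrow> w B i = w B' i"
    and finite_coins: "finite I"
    and prob: "0 \<le> \<tau>" "\<tau> \<le> 1"
begin

definition found :: "nat \<Rightarrow> nat set \<Rightarrow> nat" where
  "found t B = card (queried A P (w B) t \<inter> B)"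

text \<open>Since \<open>found\<close> is monotone in time, the counted steps form an initial
  segment: this is the time of the second success, truncated at \<open>K\<close>.\<close>

definition search_time :: "nat \<Rightarrow> nat set \<Rightarrow> nat" where
  "search_time K B = card {t. t < K \<and> found t B \<le> 1}"

definition fresh :: "nat \<Rightarrow> nat \<Rightarrow> nat set \<Rightarrow> bool" where
  "fresh t i B \<longleftrightarrow>
     found t B \<le> 1 \<and> A P (history A P (w B) t) = i \<and> i \<notin> queried A P (w B) t"

lemma found_mono: "s \<le> t \<Longrightarrow> found s B \<le> found t B"
  unfolding found_def using queried_mono[of s t A P "w B"] by (intro card_mono) auto

lemma found_Suc:
  "found (Suc t) B = found t B +
     of_bool (A P (history A P (w B) t) \<in> B - queried A P (w B) t)"
  by (auto simp: found_def Int_insert_left insert_absorb card_insert_if)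

text \<open>The decision to inspect \<open>i\<close> at step \<open>t\<close> is taken before coin
  \<open>i\<close> has been seen, so flipping that coin changes neither the run so far nor
  \<open>found t\<close>.\<close>

lemma fresh_cong:
  assumes "B - {i} = B' - {i}" "fresh t i B"
  shows "fresh t i B'"
proof -
  have out: "i \<notin> queried A P (w B) t"
    using assms(2) by (simp add: fresh_def)
  have eq: "w B' k = w B k" if "k \<in> queried A P (w B) t" for k
    using that out assms(1) by (intro local_values) auto
  have "queried A P (w B) t \<inter> B' = queried A P (w B) t \<inter> B"
    using out assms(1) by auto
  then show ?thesis
    using assms(2) queried_cong[of A P "w B" t "w B'", OF eq]
      history_cong[of A P "w B" t "w B'", OF eq]
    by (simp add: fresh_def found_def)
qed

lemma fresh_insert: "fresh t i (insert i B) \<longleftrightarrow> fresh t i (B - {i})"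
  using fresh_cong[of "insert i B" i "B - {i}"] fresh_cong[of "B - {i}" i "insert i B"] by auto

lemma search_time_eq_sum: "search_time K B = (\<Sum>t<K. of_bool (found t B \<le> 1))"
proof -
  have "{t. t < K \<and> found t B \<le> 1} = {..<K} \<inter> {t. found t B \<le> 1}"
    by auto
  then show ?thesis
    by (simp add: search_time_def sum_of_bool_eq)
qed

text \<open>Each success found before the search is finished comes from a fresh step. The cap at 2
  is there because \<open>fresh\<close> ignores all steps after the second success.\<close>

lemma found_le_sum_fresh:
  assumes "B \<subseteq> I"
  shows "min (found K B) 2 \<le> (\<Sum>t<K. \<Sum>i\<in>I. of_bool (fresh t i B) * of_bool (i \<in> B))"
proof (induction K)
  case 0
  show ?case by (simp add: found_def)
next
  case (Suc K)
  let ?i = "A P (history A P (w B) K)"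
  have "min (found (Suc K) B) 2 \<le> min (found K B) 2 + of_bool (fresh K ?i B \<and> ?i \<in> B)"
    by (auto simp: found_Suc fresh_def)
  also have "of_bool (fresh K ?i B \<and> ?i \<in> B) \<le>
      (\<Sum>i\<in>I. of_bool (fresh K i B) * of_bool (i \<in> B) :: nat)"
  proof (cases "fresh K ?i B \<and> ?i \<in> B")
    case True
    then have "?i \<in> I" using assms by auto
    then show ?thesis
      using True finite_coins
        member_le_sum[of ?i I "\<lambda>i. of_bool (fresh K i B) * of_bool (i \<in> B) :: nat"]
      by simp
  qed auto
  finally show ?case using Suc by simp
qed

text \<open>One step inspects only one item.\<close>

lemma sum_fresh_le: "(\<Sum>i\<in>I. of_bool (fresh t i B)) \<le> (of_bool (found t B \<le> 1) :: real)"
proof -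
  let ?i = "A P (history A P (w B) t)"
  have "(\<Sum>i\<in>I. of_bool (fresh t i B)) \<le> (\<Sum>i\<in>I. of_bool (i = ?i \<and> found t B \<le> 1) :: real)"
    by (intro sum_mono) (auto simp: fresh_def)
  also have "\<dots> \<le> of_bool (found t B \<le> 1)"
    using finite_coins by (cases "found t B \<le> 1") (auto simp: of_bool_def)
  finally show ?thesis .
qed

text \<open>Wald's identity: a coin that has not been inspected succeeds with probability \<open>\<tau>\<close>
  independently of the decision to inspect it.\<close>

lemma wald_bound:
  "2 * coin_mean \<tau> I (\<lambda>B. of_bool (found K B \<ge> 2)) \<le>
     \<tau> * coin_mean \<tau> I (\<lambda>B. real (search_time K B))"
proof -
  have "2 * coin_mean \<tau> I (\<lambda>B. of_bool (found K B \<ge> 2)) =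
      coin_mean \<tau> I (\<lambda>B. 2 * of_bool (found K B \<ge> 2))"
    by (simp only: coin_mean_cmult)
  also have "\<dots> \<le>
      coin_mean \<tau> I (\<lambda>B. \<Sum>t<K. \<Sum>i\<in>I. of_bool (fresh t i B) * of_bool (i \<in> B))"
  proof (rule coin_mean_mono[OF prob])
    fix B assume "B \<subseteq> I"
    have "2 * of_bool (found K B \<ge> 2) \<le> real (min (found K B) 2)"
      by auto
    also have "\<dots> \<le> real (\<Sum>t<K. \<Sum>i\<in>I. of_bool (fresh t i B) * of_bool (i \<in> B))"
      using found_le_sum_fresh[OF \<open>B \<subseteq> I\<close>] by (simp only: of_nat_le_iff)
    finally show "2 * of_bool (found K B \<ge> 2) \<le>
        (\<Sum>t<K. \<Sum>i\<in>I. of_bool (fresh t i B) * of_bool (i \<in> B) :: real)"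
      by simp
  qed
  also have "\<dots> = (\<Sum>t<K. \<Sum>i\<in>I. \<tau> * coin_mean \<tau> I (\<lambda>B. of_bool (fresh t i B)))"
    unfolding coin_mean_sum using finite_coins
    by (intro sum.cong refl coin_mean_independent) (simp_all add: fresh_insert)
  also have "\<dots> = \<tau> * coin_mean \<tau> I (\<lambda>B. \<Sum>t<K. \<Sum>i\<in>I. of_bool (fresh t i B))"
    by (simp add: coin_mean_sum sum_distrib_left)
  also have "\<dots> \<le> \<tau> * coin_mean \<tau> I (\<lambda>B. \<Sum>t<K. of_bool (found t B \<le> 1))"
    using prob by (intro mult_left_mono coin_mean_mono sum_mono sum_fresh_le) auto
  finally show ?thesis
    by (simp add: search_time_eq_sum)
qed

lemma search_time_unsuccessful: "K * of_bool (found K B \<le> 1) \<le> search_time K B"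
proof (cases "found K B \<le> 1")
  case True
  have "found t B \<le> 1" if "t < K" for t
    using found_mono[of t K B] True that by simp
  then have "{t. t < K \<and> found t B \<le> 1} = {..<K}"
    by auto
  then show ?thesis by (simp add: search_time_def)
qed auto

lemma search_time_bound:
  assumes "0 < \<tau>" "0 < K"
  shows "2 * K / (\<tau> * K + 2) \<le> coin_mean \<tau> I (\<lambda>B. real (search_time K B))"
proof -
  define X where "X = coin_mean \<tau> I (\<lambda>B. real (search_time K B))"
  define p where "p = coin_mean \<tau> I (\<lambda>B. of_bool (found K B \<le> 1))"
  have "coin_mean \<tau> I (\<lambda>B. of_bool (found K B \<ge> 2)) =
      coin_mean \<tau> I (\<lambda>B. 1 - of_bool (found K B \<le> 1))"
    by (intro arg_cong[where f = "coin_mean \<tau> I"] ext) auto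
  also have "\<dots> = 1 - p"
    by (simp add: p_def coin_mean_diff coin_mean_const finite_coins)
  finally have 1: "2 * (1 - p) \<le> \<tau> * X"
    using wald_bound[of K] by (simp add: X_def)
  have "K * p = coin_mean \<tau> I (\<lambda>B. real K * of_bool (found K B \<le> 1))"
    by (simp only: p_def coin_mean_cmult)
  also have "\<dots> \<le> X"
    unfolding X_def
  proof (rule coin_mean_mono[OF prob])
    fix B
    show "real K * of_bool (found K B \<le> 1) \<le> real (search_time K B)"
      using search_time_unsuccessful[of K B] by (cases "found K B \<le> 1") auto
  qed
  finally have 2: "K * p \<le> X" .
  \<comment> \<open>Multiplying \<open>1\<close> by \<open>K\<close> makes the term
    \<open>K * p\<close> appear, which \<open>2\<close> then eliminates.\<close>
  have "2 * K \<le> K * (\<tau> * X) + 2 * (K * p)"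
    using mult_left_mono[OF 1, of "real K"] by (simp add: algebra_simps)
  with 2 have "2 * K \<le> X * (\<tau> * K + 2)"
    by (simp add: algebra_simps)
  moreover have "0 < \<tau> * K + 2"
    using assms by (simp add: add_pos_pos)
  ultimately show ?thesis
    by (simp add: X_def pos_divide_le_eq)
qed

lemma less_search_timeD:
  assumes "k < search_time K B"
  shows "k < K" "found k B \<le> 1"
proof -
  have "search_time K B \<le> card {..<K}"
    unfolding search_time_def by (intro card_mono) auto
  with assms show "k < K" by simp
  show "found k B \<le> 1"
  proof (rule ccontr)
    assume *: "\<not> found k B \<le> 1"
    have "t < k" if "found t B \<le> 1" for t
      using found_mono[of k t B] * that by (meson le_trans not_le)
    then have "search_time K B \<le> card {..<k}"
      unfolding search_time_def by (intro card_mono) auto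
    with assms show False by simp
  qed
qed

end

subsection \<open>The hard instances\<close>

text \<open>Item \<open>n\<close> is the trivial competitor. Item \<open>j\<close> is the special one, for which either
  outcome of its coin alone settles the instance; for \<open>j > n\<close> there is no special item.
  Both outcomes of the special coin get distinct values so that the values determine all coins.\<close>

definition hard_input :: "nat \<Rightarrow> minset_input" where
  "hard_input n = \<lparr>intervals = replicate n (0, 1) @ [(3/4, 3/4)], family = {{..<n}, {n}}\<rparr>"

text \<open>The value 1/2 is the midpoint of (0, 1), so it counts towards the balancing parameter.
  The small value is chosen so that \<open>n\<close> copies sum to less than 1/4 = 3/4 -
  1/2.\<close>

definition hard_value :: "nat \<Rightarrow> nat \<Rightarrow> nat \<Rightarrow> bool \<Rightarrow> real" where
  "hard_value n j i b =
     (if i = n then 3/4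
      else if i = j then (if b then 7/8 else 15/16)
      else if b then 1/2 else 1 / (4 * (real n + 1)))"

text \<open>Restricted to \<open>{..n}\<close> in order to be a point of the product space.\<close>

definition hard_outcome :: "nat \<Rightarrow> nat \<Rightarrow> nat set \<Rightarrow> nat \<Rightarrow> real" where
  "hard_outcome n j B = (\<lambda>i\<in>{..n}. hard_value n j i (i \<in> B))"

definition hard_dist :: "real \<Rightarrow> nat \<Rightarrow> nat \<Rightarrow> nat \<Rightarrow> real measure" where
  "hard_dist \<tau> n j i = distr (measure_pmf (bernoulli_pmf \<tau>)) borel (hard_value n j i)"

lemma items_hard [simp]: "items (hard_input n) = {..n}"
  by (auto simp: items_def hard_input_def)

lemma family_hard [simp]: "family (hard_input n) = {{..<n}, {n}}"
  by (simp add: hard_input_def)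

lemma lower_hard: "i \<le> n \<Longrightarrow> lower (hard_input n) i = (if i = n then 3/4 else 0)"
  by (simp add: lower_def hard_input_def nth_append)

lemma upper_hard: "i \<le> n \<Longrightarrow> upper (hard_input n) i = (if i = n then 3/4 else 1)"
  by (simp add: upper_def hard_input_def nth_append)

lemma valid_hard: "valid_input (hard_input n)"
  by (auto simp: valid_input_def lower_hard upper_hard)

lemma small_value_bounds:
  "0 < 1 / (4 * (real n + 1))" "1 / (4 * (real n + 1)) < 1/2" "real n * (1 / (4 * (real n + 1))) < 1/4"
  by (auto simp: field_simps)

lemma hard_value_pos: "0 < hard_value n j i b"
  using small_value_bounds(1)[of n] by (simp add: hard_value_def)

lemma hard_value_in_interval:
  assumes "i \<le> n"
  shows "hard_value n j i b \<in> interval (hard_input n) i"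
  using assms small_value_bounds(1,2)[of n]
  by (auto simp: interval_def lower_hard upper_hard hard_value_def)

lemma hard_value_eq_iff: "i \<noteq> n \<Longrightarrow> hard_value n j i b = hard_value n j i b' \<longleftrightarrow> b = b'"
  using small_value_bounds(2)[of n] by (auto simp: hard_value_def)

text \<open>Distinct coin outcomes give distinct atoms, so a sum of their indicators has at most one
  nonzero term at each point.\<close>

lemma inj_on_hard_outcome: "inj_on (hard_outcome n j) (Pow {..<n})"
proof (rule inj_onI)
  fix B B' assume B: "B \<in> Pow {..<n}" "B' \<in> Pow {..<n}"
    and eq: "hard_outcome n j B = hard_outcome n j B'"
  have "i \<in> B \<longleftrightarrow> i \<in> B'" if "i < n" for i
    using fun_cong[OF eq, of i] that by (simp add: hard_outcome_def hard_value_eq_iff)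
  with B show "B = B'" by blast
qed

lemma min_value_hard:
  assumes "j < n" "w n = 3/4" "\<And>i. i < n \<Longrightarrow> 0 \<le> w i" "7/8 \<le> w j"
  shows "min_value (hard_input n) w = 3/4"
proof -
  have "w j \<le> (\<Sum>i<n. w i)"
    using assms by (intro member_le_sum) auto
  then show ?thesis
    using assms by (simp add: min_value_def set_value_def)
qed

text \<open>Querying \<open>j\<close> lifts the lower limit of its set to at least 7/8, and the
  trivial competitor is known to equal 3/4.\<close>

lemma opt_hard_le:
  assumes "j < n" "w n = 3/4" "\<And>i. i < n \<Longrightarrow> 0 \<le> w i" "7/8 \<le> w j"
  shows "opt (hard_input n) w \<le> 1"
proof -
  have "{n} - {j} = {n}" "{n} \<inter> {j} = {}" "{..<n} \<inter> {j} = {j}"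
    using assms(1) by auto
  then have "feasible (hard_input n) w {j}"
    using assms(1,4)
    by (auto simp: feasible_def min_value_hard[OF assms] lower_limit_def upper_limit_def
        lower_hard upper_hard)
  moreover have "finite {Q. feasible (hard_input n) w Q}"
    by (rule finite_subset[of _ "Pow {..n}"]) (auto simp: feasible_def)
  ultimately have "opt (hard_input n) w \<le> card {j}"
    unfolding opt_def by (intro Min_le imageI finite_imageI) auto
  then show ?thesis by simp
qed

text \<open>At most one queried value is 1/2 and the small ones sum to less than 1/4, so the lower
  limit of \<open>{..<n}\<close> stays below the minimum 3/4.\<close>

lemma infeasible_hard:
  assumes "j < n" "j \<notin> Q" "card (Q \<inter> B) \<le> 1" "finite Q"
  shows "\<not> feasible (hard_input n) (hard_outcome n j B) Q"
proof
  let ?w = "hard_outcome n j B" and ?d = "1 / (4 * (real n + 1))"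
  assume "feasible (hard_input n) ?w Q"
  moreover have "min_value (hard_input n) ?w = 3/4"
    using assms(1) hard_value_pos
    by (intro min_value_hard) (auto simp: hard_outcome_def hard_value_def)
  ultimately have "3/4 \<le> lower_limit (hard_input n) ?w Q {..<n}"
    by (auto simp: feasible_def)
  also have "\<dots> = (\<Sum>i\<in>{..<n} \<inter> Q. ?w i)"
    by (simp add: lower_limit_def lower_hard)
  also have "\<dots> \<le> (\<Sum>i\<in>{..<n} \<inter> Q. ?d + of_bool (i \<in> B) * (1/2))"
    using assms(2) small_value_bounds(1)[of n]
    by (intro sum_mono) (auto simp: hard_outcome_def hard_value_def)
  also have "\<dots> = card ({..<n} \<inter> Q) * ?d + card ({..<n} \<inter> Q \<inter> B) * (1/2)"
    by (simp only: sum.distrib sum_distrib_right[symmetric] sum_of_bool_eq sum_constant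
        finite_Int finite_lessThan Collect_mem_eq) simp
  also have "\<dots> \<le> n * ?d + 1 * (1/2)"
  proof (intro add_mono mult_right_mono)
    show "real (card ({..<n} \<inter> Q)) \<le> real n"
      using card_mono[of "{..<n}" "{..<n} \<inter> Q"] by simp
    show "real (card ({..<n} \<inter> Q \<inter> B)) \<le> 1"
      using card_mono[of "Q \<inter> B" "{..<n} \<inter> Q \<inter> B"] assms(3,4) by fastforce
  qed (use small_value_bounds(1)[of n] in auto)
  also have "\<dots> < 3/4"
    using small_value_bounds(3)[of n] by simp
  finally show False by simp
qed

section \<open>Distribution, balancing parameter and expected costs of the hard instances\<close>

context
  fixes \<tau> :: real and n j :: nat
  assumes \<tau>: "0 < \<tau>" "\<tau> \<le> 1" and j: "j < n"
begin

lemma prob_space_hard_dist: "prob_space (hard_dist \<tau> n j i)"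
  unfolding hard_dist_def by (intro prob_space.prob_space_distr prob_space_measure_pmf) auto

lemma sets_hard_dist [simp]: "sets (hard_dist \<tau> n j i) = sets borel"
  by (simp add: hard_dist_def)

lemma emeasure_hard_dist:
  assumes "X \<in> sets borel"
  shows "emeasure (hard_dist \<tau> n j i) X =
    ennreal (\<tau> * of_bool (hard_value n j i True \<in> X) + (1 - \<tau>) * of_bool (hard_value n j i False \<in> X))"
proof -
  have "emeasure (hard_dist \<tau> n j i) X =
      emeasure (measure_pmf (bernoulli_pmf \<tau>)) (hard_value n j i -` X)"
    using assms by (simp add: hard_dist_def emeasure_distr)
  also have "\<dots> = (\<integral>\<^sup>+ b. indicator (hard_value n j i -` X) b \<partial>measure_pmf (bernoulli_pmf \<tau>))"
    by simp
  also have "\<dots> = ennreal (\<tau> * of_bool (hard_value n j i True \<in> X) +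
      (1 - \<tau>) * of_bool (hard_value n j i False \<in> X))"
    using \<tau> by (subst nn_integral_bernoulli_pmf)
      (auto simp: indicator_def ennreal_mult' ennreal_plus[symmetric] simp del: ennreal_plus)
  finally show ?thesis .
qed

lemma AE_hard_dist:
  assumes "\<And>b. Q (hard_value n j i b)" "{x. Q x} \<in> sets borel"
  shows "AE x in hard_dist \<tau> n j i. Q x"
  unfolding hard_dist_def using assms by (subst AE_distr_iff) auto

lemma valid_instance_hard: "valid_instance (hard_input n, hard_dist \<tau> n j)"
proof -
  have "AE x in hard_dist \<tau> n j i. x \<in> interval (hard_input n) i" if "i \<le> n" for i
    using that hard_value_in_interval by (intro AE_hard_dist) (auto simp: interval_def)
  then show ?thesis
    by (simp add: valid_instance_def valid_hard prob_space_hard_dist)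
qed

text \<open>Items \<open>n\<close> and \<open>j\<close> always reach their midpoints. The bound on
  \<open>n\<close> provides a further item, which does so with probability \<tau>.\<close>

lemma balancing_hard:
  assumes "2 \<le> n"
  shows "balancing (hard_input n, hard_dist \<tau> n j) = \<tau>"
proof -
  let ?f = "\<lambda>i. measure (hard_dist \<tau> n j i)
    {x. x \<ge> (upper (hard_input n) i + lower (hard_input n) i) / 2}"
  have f: "?f i = (if i = n \<or> i = j then 1 else \<tau>)" if "i \<le> n" for i
    using that j small_value_bounds(2)[of n] \<tau>
    by (auto simp: measure_def emeasure_hard_dist lower_hard upper_hard hard_value_def
        ennreal_plus[symmetric] simp del: ennreal_plus)
  obtain k where "k < n" "k \<noteq> j"
    using assms by (metis less_le_trans pos2 one_less_numeral_iff semiring_norm(76) zero_neq_one)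
  then have "\<tau> \<in> ?f ` {..n}"
    using f[of k] by (intro image_eqI[of _ _ k]) auto
  moreover have "\<tau> \<le> x" if "x \<in> ?f ` {..n}" for x
    using that f \<tau>(2) by auto
  ultimately show ?thesis
    unfolding balancing_def prod.case items_hard by (intro Min_eqI finite_imageI finite_atMost)
qed

lemma expected_opt_hard_le: "expected_opt (hard_input n, hard_dist \<tau> n j) \<le> 1"
proof -
  let ?M = "PiM {..n} (hard_dist \<tau> n j)"
  interpret product_prob_space "hard_dist \<tau> n j" "{..n}"
    by (intro product_prob_spaceI prob_space_hard_dist)
  have AE: "AE w in ?M. Q (w i)" if "i \<le> n" "\<And>b. Q (hard_value n j i b)" "{x. Q x} \<in> sets borel"
    for i Q using that by (intro AE_PiM_component prob_space_hard_dist AE_hard_dist) auto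
  have "AE w in ?M. w n = 3/4"
    by (rule AE) (auto simp: hard_value_def)
  moreover have "AE w in ?M. 7/8 \<le> w j"
    using j by (intro AE) (auto simp: hard_value_def)
  moreover have "AE w in ?M. \<forall>i\<in>{..<n}. 0 \<le> w i"
    using hard_value_pos by (intro AE_finite_allI AE) (auto intro: less_imp_le)
  ultimately have "AE w in ?M. of_nat (opt (hard_input n) w) \<le> (1 :: ennreal)"
  proof eventually_elim
    case (elim w)
    then have "opt (hard_input n) w \<le> 1"
      using j by (intro opt_hard_le) auto
    then show ?case
      by (metis of_nat_1 of_nat_mono)
  qed
  then have "expected_opt (hard_input n, hard_dist \<tau> n j) \<le> (\<integral>\<^sup>+ w. 1 \<partial>?M)"
    unfolding expected_opt_def value_space_def fst_conv prod.case items_hard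
    by (rule nn_integral_mono_AE)
  also have "\<dots> = 1"
    by (simp add: P.emeasure_space_1)
  finally show ?thesis .
qed

text \<open>The trivial item contributes the factor 1. Every other item, the special one included,
  has two distinct values and contributes the weight of its coin.\<close>

lemma emeasure_hard_outcome:
  assumes "B \<subseteq> {..<n}"
  shows "{hard_outcome n j B} \<in> sets (PiM {..n} (hard_dist \<tau> n j))"
    and "emeasure (PiM {..n} (hard_dist \<tau> n j)) {hard_outcome n j B} = coin_weight \<tau> {..<n} B"
proof -
  interpret product_prob_space "hard_dist \<tau> n j" "{..n}"
    by (intro product_prob_spaceI prob_space_hard_dist)
  let ?w = "hard_outcome n j B"
  have w: "{?w} = (\<Pi>\<^sub>E i\<in>{..n}. {?w i})"
    by (subst PiE_singleton) (auto simp: hard_outcome_def)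
  show "{?w} \<in> sets (PiM {..n} (hard_dist \<tau> n j))"
    unfolding w by (intro sets_PiM_I_finite) auto
  have d: "emeasure (hard_dist \<tau> n j i) {?w i} =
      ennreal (if i = n then 1 else if i \<in> B then \<tau> else 1 - \<tau>)" if "i \<le> n" for i
    using that hard_value_eq_iff[of i n j]
    by (cases "i = n") (auto simp: emeasure_hard_dist hard_outcome_def hard_value_def[of n j n])
  have "emeasure (PiM {..n} (hard_dist \<tau> n j)) {?w} =
      (\<Prod>i\<le>n. emeasure (hard_dist \<tau> n j i) {?w i})"
    unfolding w by (intro emeasure_PiM) auto
  also have "\<dots> = (\<Prod>i\<le>n. ennreal (if i = n then 1 else if i \<in> B then \<tau> else 1 - \<tau>))"
    by (intro prod.cong) (auto simp: d)
  also have "\<dots> = (\<Prod>i<n. ennreal (if i \<in> B then \<tau> else 1 - \<tau>))"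
    by (subst lessThan_Suc_atMost[symmetric], subst prod.lessThan_Suc) (auto intro!: prod.cong)
  also have "\<dots> = coin_weight \<tau> {..<n} B"
    unfolding coin_weight_def using \<tau> by (intro prod_ennreal) auto
  finally show "emeasure (PiM {..n} (hard_dist \<tau> n j)) {?w} = coin_weight \<tau> {..<n} B" .
qed

text \<open>Only the atoms are used, because the cost of \<open>A\<close> need not be measurable.\<close>

lemma expected_alg_hard_ge:
  assumes "\<And>B. B \<subseteq> {..<n} \<Longrightarrow> enat (m B) \<le> alg A (hard_input n) (hard_outcome n j B)"
  shows "ennreal (coin_mean \<tau> {..<n} (\<lambda>B. real (m B))) \<le>
    expected_alg A (hard_input n, hard_dist \<tau> n j)"
proof -
  let ?M = "PiM {..n} (hard_dist \<tau> n j)" and ?w = "hard_outcome n j"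
  let ?f = "\<lambda>w. ennreal_of_enat (alg A (hard_input n) w)"
  have "ennreal (coin_mean \<tau> {..<n} (\<lambda>B. real (m B))) =
      (\<Sum>B\<in>Pow {..<n}. ennreal (real (m B)) * emeasure ?M {?w B})"
    unfolding coin_mean_def using \<tau>
    by (subst sum_ennreal[symmetric])
      (auto intro!: sum.cong mult_nonneg_nonneg coin_weight_nonneg
        simp: emeasure_hard_outcome ennreal_mult' coin_weight_nonneg mult.commute)
  also have "\<dots> = (\<Sum>B\<in>Pow {..<n}. \<integral>\<^sup>+ w. ennreal (real (m B)) * indicator {?w B} w \<partial>?M)"
    by (intro sum.cong refl nn_integral_cmult_indicator[symmetric] emeasure_hard_outcome) auto
  also have "\<dots> = (\<integral>\<^sup>+ w. (\<Sum>B\<in>Pow {..<n}. ennreal (real (m B)) * indicator {?w B} w) \<partial>?M)"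
    using emeasure_hard_outcome
    by (intro nn_integral_sum[symmetric] borel_measurable_times borel_measurable_indicator) auto
  also have "\<dots> \<le> (\<integral>\<^sup>+ w. ?f w \<partial>?M)"
  proof (intro nn_integral_mono)
    fix w
    show "(\<Sum>B\<in>Pow {..<n}. ennreal (real (m B)) * indicator {?w B} w) \<le> ?f w"
    proof (cases "w \<in> ?w ` Pow {..<n}")
      case True
      then obtain B where B: "B \<subseteq> {..<n}" "w = ?w B" by auto
      \<comment> \<open>By injectivity only the term of \<open>B\<close> survives.\<close>
      have "(\<Sum>B'\<in>Pow {..<n}. ennreal (real (m B')) * indicator {?w B'} w) =
          (\<Sum>B'\<in>Pow {..<n}. if B' = B then ennreal (real (m B)) else 0)"
        using inj_on_hard_outcome[of n j] B
        by (intro sum.cong) (auto simp: inj_on_def indicator_def)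
      also have "\<dots> = of_nat (m B)"
        using B by (simp add: ennreal_of_nat_eq_real_of_nat)
      also have "\<dots> = ennreal_of_enat (enat (m B))"
        by simp
      also have "\<dots> \<le> ?f w"
        using assms[OF B(1)] B(2) by (simp only: ennreal_of_enat_le_iff)
      finally show ?thesis .
    next
      case False
      then have "(\<Sum>B\<in>Pow {..<n}. ennreal (real (m B)) * indicator {?w B} w) = 0"
        by (intro sum.neutral) (auto simp: indicator_def)
      then show ?thesis by simp
    qed
  qed
  finally show ?thesis
    by (simp add: expected_alg_def value_space_def)
qed

end

section \<open>Averaging over the position of the special item\<close>

text \<open>Until the special item is queried, the run is the same as without special item.\<close>

lemma exists_hard_instance:
  assumes \<tau>: "0 < \<tau>" "\<tau> \<le> 1" and A: "deterministic_algorithm A" and K: "0 < K" "K \<le> n"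
  shows "\<exists>j<n. ennreal ((real n - real K) / real n * (2 * real K / (\<tau> * real K + 2))) \<le>
    expected_alg A (hard_input n, hard_dist \<tau> n j)"
proof -
  let ?P = "hard_input n" and ?w = "hard_outcome n (Suc n)"
  \<comment> \<open>Since \<open>Suc n\<close> lies outside the items, this run has no special item
    and is the same for all \<open>j\<close>.\<close>
  interpret coin_search A ?P ?w "{..<n}" \<tau>
    using \<tau> by unfold_locales (auto simp: hard_outcome_def)
  \<comment> \<open>A lower bound for the cost when \<open>j\<close> is special: the search time if
    the reference run misses \<open>j\<close> in its first \<open>K\<close> queries, and 0
    otherwise.\<close>
  define m where "m j B = of_bool (j \<notin> queried A ?P (?w B) K) * search_time K B" for j B
  have in_items: "queried A ?P w k \<subseteq> {..n}" for w k
    using A valid_hard[of n] by (induction k) (auto simp: deterministic_algorithm_def)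
  have alg: "enat (m j B) \<le> alg A ?P (hard_outcome n j B)" if "j < n" for j B
    unfolding alg_def
  proof (rule INF_greatest)
    fix k assume k: "k \<in> {k. feasible ?P (hard_outcome n j B) (queried A ?P (hard_outcome n j B) k)}"
    show "enat (m j B) \<le> enat k"
    proof (rule ccontr)
      assume "\<not> enat (m j B) \<le> enat k"
      then have less: "k < search_time K B" and j: "j \<notin> queried A ?P (?w B) K"
        by (auto simp: m_def of_bool_def split: if_splits)
      note kK = less_search_timeD[OF less]
      have j': "j \<notin> queried A ?P (?w B) k"
        using j queried_mono[of k K A ?P "?w B"] kK(1) by auto
      have "queried A ?P (hard_outcome n j B) k = queried A ?P (?w B) k"
      proof (rule queried_cong)
        fix i assume "i \<in> queried A ?P (?w B) k"
        then have "i \<noteq> j" "i \<le> n"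
          using j' in_items by auto
        then show "hard_outcome n j B i = ?w B i"
          by (simp add: hard_outcome_def hard_value_def)
      qed
      with k infeasible_hard[OF \<open>j < n\<close> j'] kK(2) show False
        by (auto simp: found_def)
    qed
  qed
  \<comment> \<open>The first \<open>K\<close> queries miss at least \<open>n - K\<close> of the
    positions \<open>j\<close>, and each of these contributes the full search time.\<close>
  have "(real n - real K) * real (search_time K B) \<le> (\<Sum>j<n. real (m j B))" for B
  proof -
    let ?Q = "queried A ?P (?w B) K"
    have "n - K \<le> card ({..<n} - ?Q)"
      using diff_card_le_card_Diff[of ?Q "{..<n}"] card_queried_le[of A ?P "?w B" K] by simp
    also have "\<dots> = (\<Sum>j<n. of_bool (j \<notin> ?Q))"
      by (simp add: sum_of_bool_eq Diff_eq Compl_eq)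
    finally have "real (n - K) \<le> real (\<Sum>j<n. of_bool (j \<notin> ?Q))"
      by (simp only: of_nat_le_iff)
    then have "real n - real K \<le> (\<Sum>j<n. of_bool (j \<notin> ?Q))"
      using K by (simp add: of_nat_diff)
    then have "(real n - real K) * real (search_time K B) \<le>
        (\<Sum>j<n. of_bool (j \<notin> ?Q)) * real (search_time K B)"
      by (rule mult_right_mono) simp
    then show ?thesis
      by (simp add: m_def sum_distrib_right)
  qed
  then have "(real n - real K) * coin_mean \<tau> {..<n} (\<lambda>B. real (search_time K B)) \<le>
      coin_mean \<tau> {..<n} (\<lambda>B. \<Sum>j<n. real (m j B))"
    unfolding coin_mean_cmult[symmetric] using \<tau> by (intro coin_mean_mono) auto
  moreover have "(real n - real K) * (2 * real K / (\<tau> * real K + 2)) \<le>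
      (real n - real K) * coin_mean \<tau> {..<n} (\<lambda>B. real (search_time K B))"
    using search_time_bound[of K] \<tau> K by (intro mult_left_mono) auto
  ultimately have sum: "(real n - real K) * (2 * real K / (\<tau> * real K + 2)) \<le>
      (\<Sum>j<n. coin_mean \<tau> {..<n} (\<lambda>B. real (m j B)))"
    by (simp add: coin_mean_sum)
  define c where "c = (real n - real K) / real n * (2 * real K / (\<tau> * real K + 2))"
  have c: "(real n - real K) * (2 * real K / (\<tau> * real K + 2)) = real n * c"
    using K by (simp add: c_def)
  \<comment> \<open>Some position does at least as well as the average \<open>c\<close>.\<close>
  have "\<exists>j<n. c \<le> coin_mean \<tau> {..<n} (\<lambda>B. real (m j B))"
  proof (rule ccontr)
    assume "\<not> ?thesis"
    then have "(\<Sum>j<n. coin_mean \<tau> {..<n} (\<lambda>B. real (m j B))) < (\<Sum>j<n. c)"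
      using K by (intro sum_strict_mono) (auto simp: lessThan_empty_iff)
    then show False using sum c by simp
  qed
  then obtain j where j: "j < n" "c \<le> coin_mean \<tau> {..<n} (\<lambda>B. real (m j B))"
    by blast
  have "ennreal c \<le> expected_alg A (?P, hard_dist \<tau> n j)"
    using ennreal_leI[OF j(2)] expected_alg_hard_ge[OF \<tau> j(1), of "m j" A] alg[OF j(1)]
    by (blast intro: order_trans)
  with j(1) show ?thesis
    unfolding c_def by blast
qed

text \<open>Reduces the ratio to its numerator once the expected optimum is at most 1. The case
  \<open>y = 0\<close> is covered because its inverse is infinite.\<close>

lemma le_divide_ennreal:
  fixes x y :: ennreal
  assumes "y \<le> 1"
  shows "x \<le> x / y"
proof -
  have "1 \<le> inverse y"
  proof (cases y)
    case (real r)
    then have "r \<le> 1" using assms by simp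
    then show ?thesis
      using real by (cases "r = 0") (auto simp: inverse_ennreal one_le_inverse)
  qed (use assms in \<open>simp add: top_unique\<close>)
  then show ?thesis
    using mult_left_mono[of 1 "inverse y" x] by (simp add: divide_ennreal_def)
qed

section \<open>Passage to the limit\<close>

theorem theorem2:
  fixes \<tau> :: real and A :: strategy
  assumes "0 < \<tau>" and "\<tau> \<le> 1"
    and "deterministic_algorithm A"
  shows "competitive_ratio A
           {J. valid_instance J \<and> balancing J = \<tau> \<and> disjoint (family (fst J))}
         \<ge> ennreal (2 / \<tau>)"
proof -
  let ?C = "{J. valid_instance J \<and> balancing J = \<tau> \<and> disjoint (family (fst J))}"
  define c where
    "c K = (real (K\<^sup>2) - real K) / real (K\<^sup>2) * (2 * real K / (\<tau> * real K + 2))" for K :: nat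
  \<comment> \<open>With K squared positions the first factor, 1 - 1/K, tends to 1, while the second
    tends to 2/\<tau>.\<close>
  have "c \<longlonglongrightarrow> 2 / \<tau>"
    unfolding c_def using assms(1) by (real_asymp simp: divide_inverse)
  then have lim: "(\<lambda>K. ennreal (c K)) \<longlonglongrightarrow> ennreal (2 / \<tau>)"
    by (rule tendsto_ennrealI)
  have bound: "ennreal (c K) \<le> competitive_ratio A ?C" if K: "2 \<le> K" for K
  proof -
    have "2 \<le> K\<^sup>2" "K \<le> K\<^sup>2" "0 < K"
      using K self_le_power[of K 2] by auto
    then obtain j where j: "j < K\<^sup>2"
      "ennreal (c K) \<le> expected_alg A (hard_input (K\<^sup>2), hard_dist \<tau> (K\<^sup>2) j)"
      using exists_hard_instance[OF assms, of K "K\<^sup>2"] unfolding c_def by blast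
    let ?J = "(hard_input (K\<^sup>2), hard_dist \<tau> (K\<^sup>2) j)"
    have "?J \<in> ?C"
      using valid_instance_hard[OF assms(1,2) j(1)] balancing_hard[OF assms(1,2) j(1) \<open>2 \<le> K\<^sup>2\<close>]
      by (auto simp: disjoint_def)
    have "ennreal (c K) \<le> expected_alg A ?J / expected_opt ?J"
      using j(2) le_divide_ennreal[OF expected_opt_hard_le[OF assms(1,2) j(1)]]
      by (rule order_trans)
    also have "\<dots> \<le> competitive_ratio A ?C"
      unfolding competitive_ratio_def using \<open>?J \<in> ?C\<close> by (rule SUP_upper)
    finally show ?thesis .
  qed
  show ?thesis
    by (rule LIMSEQ_le_const2[OF lim]) (use bound in blast)
qed

end
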